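(* Let $G$ be a finitely generated residually finite group of subexponential growth, and let $X$ and $Y$ be two finite generating sets for $G$. Then $\operatorname{dc}_X(G)=0$ if and only if $\operatorname{dc}_Y(G)=0$.
   Context: Generating sets generate $G$ as a group. For a finite generating set $Z$ of $G$, $|g|_Z$ is the word length of $g\in G$ with respect to $Z\cup Z^{-1}$, and $\mathbb{B}_Z(n)=\{g\in G : |g|_Z\leq n\}$ is the ball of radius $n$ centered at $1$ in the Cayley graph of $G$ with respect to $Z$. The degree of commutativity of $G$ with respect to $Z$ is $$\operatorname{dc}_Z(G)=\limsup_{n\to\infty}\frac{|\{(u,v)\in \mathbb{B}_Z(n)^2 : uv=vu\}|}{|\mathbb{B}_Z(n)|^2}.$$ $G$ has subexponential growth if $\lim_{n\to\infty}|\mathbb{B}_Z(n+1)|/|\mathbb{B}_Z(n)|=1$ for every finite generating set $Z$ of $G$. *)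

theory Defs
  imports "HOL-Algebra.Generated_Groups" "HOL-Library.Extended_Real"
begin

definition finite_generating_set :: "('a, 'b) monoid_scheme \<Rightarrow> 'a set \<Rightarrow> bool" where
  "finite_generating_set G Z \<longleftrightarrow>
     finite Z \<and> Z \<subseteq> carrier G \<and> generate G Z = carrier G"

definition finitely_generated :: "('a, 'b) monoid_scheme \<Rightarrow> bool" where
  "finitely_generated G \<longleftrightarrow> (\<exists>Z. finite_generating_set G Z)"

text \<open>Separation of non-trivial elements from the identity in finite quotients. Quantifying over
  normal subgroups, rather than over homomorphisms to finite groups, avoids fixing a type for
  the target groups.\<close>

definition residually_finite :: "('a, 'b) monoid_scheme \<Rightarrow> bool" where
  "residually_finite G \<longleftrightarrow>
     (\<forall>g \<in> carrier G. g \<noteq> \<one>\<^bsub>G\<^esub> \<longrightarrow>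
        (\<exists>N. N \<lhd> G \<and> finite (carrier (G Mod N)) \<and> g \<notin> N))"

text \<open>Meaningful only when \<open>g\<close> lies in the subgroup generated by \<open>Z\<close>; otherwise \<open>LEAST\<close>
  ranges over the empty set. Below it is used only for generating sets \<open>Z\<close>.\<close>

definition word_length :: "('a, 'b) monoid_scheme \<Rightarrow> 'a set \<Rightarrow> 'a \<Rightarrow> nat" where
  "word_length G Z g =
     (LEAST n. \<exists>ws. length ws = n \<and> set ws \<subseteq> Z \<union> (\<lambda>z. inv\<^bsub>G\<^esub> z) ` Z \<and>
                    foldr (\<otimes>\<^bsub>G\<^esub>) ws \<one>\<^bsub>G\<^esub> = g)"

definition word_ball :: "('a, 'b) monoid_scheme \<Rightarrow> 'a set \<Rightarrow> nat \<Rightarrow> 'a set" where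
  "word_ball G Z n = {g \<in> carrier G. word_length G Z g \<le> n}"

text \<open>The upper limit is taken in the extended reals, where it always exists; the sequence itself
  takes values between 0 and 1.\<close>

definition degree_of_commutativity :: "('a, 'b) monoid_scheme \<Rightarrow> 'a set \<Rightarrow> ereal" where
  "degree_of_commutativity G Z =
     limsup (\<lambda>n. ereal (
       real (card {(u, v) \<in> word_ball G Z n \<times> word_ball G Z n. u \<otimes>\<^bsub>G\<^esub> v = v \<otimes>\<^bsub>G\<^esub> u})
         / (real (card (word_ball G Z n)))\<^sup>2))"

definition subexponential_growth :: "('a, 'b) monoid_scheme \<Rightarrow> bool" where
  "subexponential_growth G \<longleftrightarrow>
     (\<forall>Z. finite_generating_set G Z \<longrightarrow>
        (\<lambda>n. real (card (word_ball G Z (n + 1))) / real (card (word_ball G Z n))) \<longlonglongrightarrow> 1)"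

end

theory Submission
  imports Defs
begin

text \<open>Call \<open>G\<close> virtually abelian if some normal subgroup \<open>N\<close> of finite index is abelian. Whether
  the degree of commutativity vanishes depends only on this property. If \<open>G\<close> is virtually abelian,
  then \<open>N\<close> has positive density in the balls, hence \<open>N \<times> N\<close> provides a positive proportion of
  commuting pairs. Otherwise residual finiteness yields a chain \<open>G = K\<^sub>0 \<supseteq> K\<^sub>1 \<supseteq> \<dots>\<close> of normal subgroups
  of finite index and \<open>a\<^sub>i, b\<^sub>i \<in> K\<^sub>i\<close> that do not commute modulo \<open>K\<^sub>i\<^sub>+\<^sub>1\<close>. Translate a pair
  \<open>(x, y)\<close> by products of the \<open>a\<^sub>i\<close> and of the \<open>b\<^sub>i\<close> respectively, each factor being present or
  absent: of the \<open>4\<^sup>k\<close> translates at most \<open>3\<^sup>k\<close> commute modulo \<open>K\<^sub>k\<close>, since at each level one of the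
  four choices fails. As balls are asymptotically invariant under translations, averaging bounds the
  degree of commutativity by \<open>(3/4)\<^sup>k\<close>.\<close>

section \<open>Balls\<close>

context group
begin

lemma foldr_mult_closed:
  "set ws \<subseteq> carrier G \<Longrightarrow> foldr (\<otimes>) ws \<one> \<in> carrier G"
  by (induction ws) auto

lemma foldr_mult_append:
  assumes "set us \<subseteq> carrier G" "set vs \<subseteq> carrier G"
  shows "foldr (\<otimes>) (us @ vs) \<one> = foldr (\<otimes>) us \<one> \<otimes> foldr (\<otimes>) vs \<one>"
  using assms by (induction us) (auto simp: foldr_mult_closed m_assoc)

lemma generate_imp_word:
  assumes "Z \<subseteq> carrier G" "g \<in> generate G Z"
  shows "\<exists>ws. set ws \<subseteq> Z \<union> (\<lambda>z. inv z) ` Z \<and> foldr (\<otimes>) ws \<one> = g"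
  using assms(2)
proof induction
  case one
  show ?case by (rule exI[of _ "[]"]) simp
next
  case (incl h)
  then show ?case using assms(1) by (intro exI[of _ "[h]"]) auto
next
  case (inv h)
  then show ?case using assms(1) by (intro exI[of _ "[inv h]"]) auto
next
  case (eng h1 h2)
  then obtain us vs where "set us \<subseteq> Z \<union> (\<lambda>z. inv z) ` Z" "foldr (\<otimes>) us \<one> = h1"
      "set vs \<subseteq> Z \<union> (\<lambda>z. inv z) ` Z" "foldr (\<otimes>) vs \<one> = h2"
    by blast
  moreover have "Z \<union> (\<lambda>z. inv z) ` Z \<subseteq> carrier G" using assms(1) by auto
  ultimately show ?case
    by (intro exI[of _ "us @ vs"]) (subst foldr_mult_append, auto)
qed

text \<open>As \<open>Z\<close> generates the group, every element is the value of some word, so the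
  \<open>LEAST\<close> in \<open>word_length\<close> is attained. From here on balls are handled
  through words of bounded length.\<close>

lemma word_ball_iff:
  assumes "finite_generating_set G Z"
  shows "g \<in> word_ball G Z n \<longleftrightarrow>
    (\<exists>ws. length ws \<le> n \<and> set ws \<subseteq> Z \<union> (\<lambda>z. inv z) ` Z \<and> foldr (\<otimes>) ws \<one> = g)"
    (is "_ \<longleftrightarrow> ?R")
proof
  let ?P = "\<lambda>n. \<exists>ws. length ws = n \<and> set ws \<subseteq> Z \<union> (\<lambda>z. inv z) ` Z \<and> foldr (\<otimes>) ws \<one> = g"
  have Z: "Z \<subseteq> carrier G" "generate G Z = carrier G"
    using assms by (auto simp: finite_generating_set_def)
  {
    assume g: "g \<in> word_ball G Z n"
    then have "g \<in> generate G Z" using Z by (simp add: word_ball_def)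
    then obtain m where "?P m" using generate_imp_word[OF Z(1)] by blast
    then have "?P (word_length G Z g)" unfolding word_length_def by (rule LeastI)
    moreover have "word_length G Z g \<le> n" using g by (simp add: word_ball_def)
    ultimately show ?R by metis
  next
    assume ?R
    then obtain ws where ws: "length ws \<le> n" "set ws \<subseteq> Z \<union> (\<lambda>z. inv z) ` Z"
      "foldr (\<otimes>) ws \<one> = g"
      by blast
    then have "word_length G Z g \<le> length ws" unfolding word_length_def by (intro Least_le) blast
    moreover have "set ws \<subseteq> carrier G" using ws(2) Z(1) by auto
    ultimately show "g \<in> word_ball G Z n"
      using ws foldr_mult_closed[of ws] by (simp add: word_ball_def)
  }
qed

lemma finite_word_ball:
  assumes "finite_generating_set G Z"
  shows "finite (word_ball G Z n)"
proof -
  let ?S = "Z \<union> (\<lambda>z. inv z) ` Z"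
  have "word_ball G Z n \<subseteq> (\<lambda>ws. foldr (\<otimes>) ws \<one>) ` {ws. set ws \<subseteq> ?S \<and> length ws \<le> n}"
    by (auto simp: word_ball_iff[OF assms])
  moreover have "finite ?S" using assms by (simp add: finite_generating_set_def)
  then have "finite ((\<lambda>ws. foldr (\<otimes>) ws \<one>) ` {ws. set ws \<subseteq> ?S \<and> length ws \<le> n})"
    by (intro finite_imageI finite_lists_length_le)
  ultimately show ?thesis by (rule finite_subset)
qed

lemma word_ball_mult:
  assumes "finite_generating_set G Z" "g \<in> word_ball G Z m" "h \<in> word_ball G Z n"
  shows "g \<otimes> h \<in> word_ball G Z (m + n)"
proof -
  let ?S = "Z \<union> (\<lambda>z. inv z) ` Z"
  have "?S \<subseteq> carrier G" using assms(1) by (auto simp: finite_generating_set_def)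
  moreover obtain us vs where "length us \<le> m" "set us \<subseteq> ?S" "foldr (\<otimes>) us \<one> = g"
    "length vs \<le> n" "set vs \<subseteq> ?S" "foldr (\<otimes>) vs \<one> = h"
    using assms(2,3) unfolding word_ball_iff[OF assms(1)] by blast
  ultimately show ?thesis unfolding word_ball_iff[OF assms(1)]
    by (intro exI[of _ "us @ vs"]) (subst foldr_mult_append, auto)
qed

lemma word_ball_subset_carrier: "word_ball G Z n \<subseteq> carrier G"
  by (auto simp: word_ball_def)

lemma card_word_ball_pos:
  assumes "finite_generating_set G Z"
  shows "0 < card (word_ball G Z n)"
proof -
  have "\<one> \<in> word_ball G Z n"
    unfolding word_ball_iff[OF assms] by (rule exI[of _ "[]"]) simp
  then show ?thesis using finite_word_ball[OF assms] card_gt_0_iff by blast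
qed

lemma finite_subset_word_ball:
  assumes "finite S" "S \<subseteq> carrier G"
  obtains c where "S \<subseteq> word_ball G Z c"
proof
  \<comment> \<open>Inserting 0 keeps \<open>Max\<close> meaningful when \<open>S\<close> is
    empty.\<close>
  show "S \<subseteq> word_ball G Z (Max (insert 0 (word_length G Z ` S)))"
    using assms by (auto simp: word_ball_def)
qed

text \<open>The ratio telescopes into \<open>c\<close> ratios of consecutive balls, each tending to
  1. Enlarging the radius by a constant, as multiplication by fixed elements does, is therefore
  asymptotically free.\<close>

lemma word_ball_growth:
  assumes "subexponential_growth G" "finite_generating_set G Z"
  shows "(\<lambda>n. real (card (word_ball G Z (n + c))) / real (card (word_ball G Z n))) \<longlonglongrightarrow> 1"
proof (induction c)
  case 0
  have "card (word_ball G Z n) \<noteq> 0" for n using card_word_ball_pos[OF assms(2), of n] by simp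
  then show ?case by (simp del: neq0_conv)
next
  case (Suc c)
  let ?b = "\<lambda>n. real (card (word_ball G Z n))"
  have "(\<lambda>n. ?b (n + 1) / ?b n) \<longlonglongrightarrow> 1"
    using assms unfolding subexponential_growth_def by blast
  then have "(\<lambda>n. ?b (n + c + 1) / ?b (n + c)) \<longlonglongrightarrow> 1"
    by (rule LIMSEQ_ignore_initial_segment)
  from tendsto_mult[OF this Suc.IH]
  have "(\<lambda>n. ?b (n + c + 1) / ?b (n + c) * (?b (n + c) / ?b n)) \<longlonglongrightarrow> 1" by simp
  moreover have "?b (n + c) \<noteq> 0" for n using card_word_ball_pos[OF assms(2), of "n + c"] by simp
  ultimately show ?case by (simp del: neq0_conv)
qed

section \<open>Virtually abelian groups\<close>

text \<open>Asking for normality loses nothing: the core of an abelian subgroup of finite index is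
  again abelian and of finite index. In this form the negation yields non-commuting elements in
  every normal subgroup of finite index.\<close>

definition virtually_abelian :: bool where
  "virtually_abelian \<longleftrightarrow>
     (\<exists>N. N \<lhd> G \<and> finite (rcosets N) \<and> (\<forall>x\<in>N. \<forall>y\<in>N. x \<otimes> y = y \<otimes> x))"

text \<open>Fix a representative \<open>t\<close> of each coset. An element \<open>g\<close> is
  determined by its coset together with \<open>g \<otimes> inv t\<close>, which lies in
  \<open>N\<close> and is longer than \<open>g\<close> by at most a constant.\<close>

lemma card_word_ball_le_subgroup:
  assumes Z: "finite_generating_set G Z" and N: "subgroup N G" "finite (rcosets N)"
  obtains c where
    "\<And>n. card (word_ball G Z n) \<le> card (rcosets N) * card (N \<inter> word_ball G Z (n + c))"
proof -
  have ex: "\<exists>t\<in>carrier G. A = N #> t" if "A \<in> rcosets N" for A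
    using that by (auto simp: RCOSETS_def)
  then obtain t where t: "\<And>A. A \<in> rcosets N \<Longrightarrow> t A \<in> carrier G \<and> A = N #> t A"
    by metis
  \<comment> \<open>There are finitely many representatives, so one radius \<open>c\<close> covers
    all their inverses.\<close>
  obtain c where c: "(\<lambda>A. inv (t A)) ` (rcosets N) \<subseteq> word_ball G Z c"
    using finite_subset_word_ball[of "(\<lambda>A. inv (t A)) ` (rcosets N)"] N(2) t by blast
  show ?thesis
  proof
    fix n
    let ?f = "\<lambda>g. (N #> g, g \<otimes> inv (t (N #> g)))"
    let ?B = "word_ball G Z n"
    have coset: "N #> g \<in> rcosets N" if "g \<in> carrier G" for g
      using that N(1) by (simp add: rcosetsI subgroup.subset)
    have "inj_on ?f ?B"
    proof (rule inj_onI)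
      fix g h assume gh: "g \<in> ?B" "h \<in> ?B" "?f g = ?f h"
      then have "g \<in> carrier G" "h \<in> carrier G" using word_ball_subset_carrier by auto
      with gh(3) t[OF coset, of g] show "g = h" by auto
    qed
    moreover have "?f ` ?B \<subseteq> (rcosets N) \<times> (N \<inter> word_ball G Z (n + c))"
    proof -
      have "?f g \<in> (rcosets N) \<times> (N \<inter> word_ball G Z (n + c))" if g: "g \<in> ?B" for g
      proof -
        have gc: "g \<in> carrier G" using g word_ball_subset_carrier by auto
        have tg: "t (N #> g) \<in> carrier G" "N #> g = N #> t (N #> g)"
          using t[OF coset[OF gc]] by auto
        have "g \<in> N #> t (N #> g)" using rcos_self[OF gc N(1)] tg(2) by simp
        then have "g \<otimes> inv (t (N #> g)) \<in> N"
          using subgroup.rcos_module_imp[OF N(1) is_group tg(1)] by simp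
        moreover have "g \<otimes> inv (t (N #> g)) \<in> word_ball G Z (n + c)"
          using c coset[OF gc] by (intro word_ball_mult[OF Z g]) auto
        ultimately show ?thesis using coset[OF gc] by simp
      qed
      then show ?thesis by blast
    qed
    moreover have "finite ((rcosets N) \<times> (N \<inter> word_ball G Z (n + c)))"
      using N(2) finite_word_ball[OF Z] by simp
    ultimately have "card ?B \<le> card ((rcosets N) \<times> (N \<inter> word_ball G Z (n + c)))"
      by (rule card_inj_on_le)
    then show "card ?B \<le> card (rcosets N) * card (N \<inter> word_ball G Z (n + c))"
      by (simp add: card_cartesian_product)
  qed
qed

text \<open>All pairs from \<open>N\<close> within the ball of radius \<open>n + c\<close> commute,
  and there are at least \<open>(?b n / d)\<^sup>2\<close> of them, where \<open>d\<close> is the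
  index of \<open>N\<close>. By subexponential growth their proportion stays asymptotically above
  \<open>(1 / d)\<^sup>2\<close>.\<close>

lemma degree_of_commutativity_pos:
  assumes growth: "subexponential_growth G" and Z: "finite_generating_set G Z"
    and va: "virtually_abelian"
  shows "0 < degree_of_commutativity G Z"
proof -
  let ?B = "word_ball G Z"
  let ?b = "\<lambda>n. real (card (?B n))"
  let ?C = "\<lambda>n. {(u, v) \<in> ?B n \<times> ?B n. u \<otimes> v = v \<otimes> u}"
  let ?r = "\<lambda>n. ereal (real (card (?C n)) / (?b n)\<^sup>2)"
  obtain N where N: "N \<lhd> G" "finite (rcosets N)" "\<forall>x\<in>N. \<forall>y\<in>N. x \<otimes> y = y \<otimes> x"
    using va by (auto simp: virtually_abelian_def)
  have sub: "subgroup N G" using N(1) by (simp add: normal_imp_subgroup)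
  obtain c where c: "\<And>n. card (?B n) \<le> card (rcosets N) * card (N \<inter> ?B (n + c))"
    using card_word_ball_le_subgroup[OF Z sub N(2)] by blast
  define d where "d = real (card (rcosets N))"
  have d: "d > 0"
    using rcosetsI[OF subgroup.subset[OF sub] one_closed] N(2)
    by (auto simp: d_def card_gt_0_iff)
  have bpos: "?b n > 0" for n using card_word_ball_pos[OF Z, of n] by simp
  have lower: "(?b n / (d * ?b (n + c)))\<^sup>2 \<le> real (card (?C (n + c))) / (?b (n + c))\<^sup>2" for n
  proof -
    let ?A = "N \<inter> ?B (n + c)"
    have "?A \<times> ?A \<subseteq> ?C (n + c)" using N(3) by auto
    moreover have "finite (?C (n + c))"
      by (rule finite_subset[of _ "?B (n + c) \<times> ?B (n + c)"]) (auto simp: finite_word_ball[OF Z])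
    ultimately have "card (?A \<times> ?A) \<le> card (?C (n + c))" by (rule card_mono[rotated])
    then have "real (card (?A \<times> ?A)) \<le> real (card (?C (n + c)))" by simp
    then have 1: "(real (card ?A))\<^sup>2 \<le> real (card (?C (n + c)))"
      by (simp add: card_cartesian_product power2_eq_square)
    have "real (card (?B n)) \<le> real (card (rcosets N) * card ?A)"
      using c[of n] by (rule of_nat_mono)
    then have "?b n / d \<le> real (card ?A)" using d by (simp add: d_def field_simps)
    then have "(?b n / d)\<^sup>2 \<le> (real (card ?A))\<^sup>2" using d by (intro power_mono) auto
    with 1 have "(?b n / d)\<^sup>2 \<le> real (card (?C (n + c)))" by linarith
    then have "(?b n / d)\<^sup>2 / (?b (n + c))\<^sup>2 \<le> real (card (?C (n + c))) / (?b (n + c))\<^sup>2"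
      by (rule divide_right_mono) simp
    then show ?thesis by (simp add: power_divide power_mult_distrib)
  qed
  \<comment> \<open>The lower bound is rewritten through the inverse of the growth ratio, whose
    limit is known.\<close>
  have "(\<lambda>n. (inverse (?b (n + c) / ?b n) / d)\<^sup>2) \<longlonglongrightarrow> (inverse 1 / d)\<^sup>2"
    using d by (intro tendsto_intros word_ball_growth[OF growth Z]) auto
  moreover have "(inverse (?b (n + c) / ?b n) / d)\<^sup>2 = (?b n / (d * ?b (n + c)))\<^sup>2" for n
    by (simp add: field_simps)
  ultimately have "(\<lambda>n. (?b n / (d * ?b (n + c)))\<^sup>2) \<longlonglongrightarrow> (1 / d)\<^sup>2" by simp
  then have "(\<lambda>n. ereal ((?b n / (d * ?b (n + c)))\<^sup>2)) \<longlonglongrightarrow> ereal ((1 / d)\<^sup>2)" by simp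
  then have "limsup (\<lambda>n. ereal ((?b n / (d * ?b (n + c)))\<^sup>2)) = ereal ((1 / d)\<^sup>2)"
    by (rule lim_imp_Limsup[rotated]) simp
  \<comment> \<open>The bound concerns only radii of the form \<open>n + c\<close>; passing to this
    subsequence cannot increase the upper limit.\<close>
  moreover have "limsup (\<lambda>n. ereal ((?b n / (d * ?b (n + c)))\<^sup>2)) \<le> limsup (?r \<circ> (\<lambda>n. n + c))"
    by (rule Limsup_mono) (use lower in \<open>simp add: o_def\<close>)
  moreover have "limsup (?r \<circ> (\<lambda>n. n + c)) \<le> limsup ?r"
    by (rule limsup_subseq_mono) (simp add: strict_mono_def)
  ultimately have "ereal ((1 / d)\<^sup>2) \<le> degree_of_commutativity G Z"
    unfolding degree_of_commutativity_def by simp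
  moreover have "0 < ereal ((1 / d)\<^sup>2)" using d by simp
  ultimately show ?thesis by (rule less_le_trans[rotated])
qed

section \<open>Groups that are not virtually abelian\<close>

lemma normal_Int:
  assumes "H \<lhd> G" "K \<lhd> G"
  shows "H \<inter> K \<lhd> G"
  using assms by (auto simp: normal_inv_iff intro: subgroups_Inter_pair)

lemma r_coset_Int:
  assumes "subgroup H G" "subgroup K G" "x \<in> carrier G"
  shows "(H \<inter> K) #> x = (H #> x) \<inter> (K #> x)"
proof -
  have "h = k" if "h \<in> H" "k \<in> K" "h \<otimes> x = k \<otimes> x" for h k
    using that assms by (meson right_cancel subgroup.mem_carrier)
  then show ?thesis unfolding r_coset_def by blast
qed

text \<open>A coset of the intersection is the intersection of a coset of \<open>H\<close> with a
  coset of \<open>K\<close>, and there are finitely many such pairs.\<close>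

lemma finite_rcosets_Int:
  assumes "subgroup H G" "subgroup K G" "finite (rcosets H)" "finite (rcosets K)"
  shows "finite (rcosets (H \<inter> K))"
proof (rule finite_subset)
  show "rcosets (H \<inter> K) \<subseteq> (\<lambda>(A, B). A \<inter> B) ` ((rcosets H) \<times> (rcosets K))"
    using assms r_coset_Int by (auto simp: RCOSETS_def)
  show "finite ((\<lambda>(A, B). A \<inter> B) ` ((rcosets H) \<times> (rcosets K)))"
    using assms by simp
qed

lemma r_coset_eq_mono:
  assumes "subgroup H G" "subgroup K G" "H \<subseteq> K" "x \<in> carrier G" "y \<in> carrier G"
    and "H #> x = H #> y"
  shows "K #> x = K #> y"
proof -
  have "x \<in> H #> y" using rcos_self[of x H] assms by simp
  then have "x \<in> K #> y" using assms(3) by (auto simp: r_coset_def)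
  then show ?thesis using repr_independence[of x K y] assms by simp
qed

section \<open>Commutation modulo a normal subgroup\<close>

text \<open>The first two equations make \<open>a\<close> commute with \<open>y\<close>, the first
  and third make \<open>b\<close> commute with \<open>x\<close>. Both sides of the fourth then start
  with \<open>y \<otimes> x\<close>, which cancels. Hence if \<open>a\<close> and \<open>b\<close>
  do not commute, one of the four pairs fails to commute.\<close>

lemma commute_of_commuting_translates:
  assumes c: "x \<in> carrier G" "y \<in> carrier G" "a \<in> carrier G" "b \<in> carrier G"
    and 1: "x \<otimes> y = y \<otimes> x"
    and 2: "x \<otimes> a \<otimes> y = y \<otimes> (x \<otimes> a)"
    and 3: "x \<otimes> (y \<otimes> b) = y \<otimes> b \<otimes> x"
    and 4: "x \<otimes> a \<otimes> (y \<otimes> b) = y \<otimes> b \<otimes> (x \<otimes> a)"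
  shows "a \<otimes> b = b \<otimes> a"
proof -
  have ya: "y \<otimes> a = a \<otimes> y"
  proof -
    have "x \<otimes> (a \<otimes> y) = x \<otimes> (y \<otimes> a)" using c 1 2 by (metis m_assoc)
    then show ?thesis using c by simp
  qed
  have xb: "x \<otimes> b = b \<otimes> x"
  proof -
    have "y \<otimes> (x \<otimes> b) = y \<otimes> (b \<otimes> x)" using c 1 3 by (metis m_assoc)
    then show ?thesis using c by simp
  qed
  have "x \<otimes> a \<otimes> (y \<otimes> b) = y \<otimes> x \<otimes> (a \<otimes> b)"
    using c 1 ya by (metis m_assoc m_closed)
  moreover have "y \<otimes> b \<otimes> (x \<otimes> a) = y \<otimes> x \<otimes> (b \<otimes> a)"
    using c xb by (metis m_assoc m_closed)
  ultimately have "y \<otimes> x \<otimes> (a \<otimes> b) = y \<otimes> x \<otimes> (b \<otimes> a)" using 4 by simp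
  then show ?thesis using c by simp
qed

text \<open>Equality of cosets keeps the arguments in \<open>G\<close>, so different
  \<open>K\<close> can be compared directly; \<open>commute_mod_iff\<close> translates to the
  quotient group.\<close>

definition commute_mod :: "'a set \<Rightarrow> 'a \<Rightarrow> 'a \<Rightarrow> bool" where
  "commute_mod K u v \<longleftrightarrow> K #> (u \<otimes> v) = K #> (v \<otimes> u)"

lemma commute_mod_iff:
  assumes "K \<lhd> G" "u \<in> carrier G" "v \<in> carrier G"
  shows "commute_mod K u v \<longleftrightarrow>
    (K #> u) \<otimes>\<^bsub>G Mod K\<^esub> (K #> v) = (K #> v) \<otimes>\<^bsub>G Mod K\<^esub> (K #> u)"
  using assms by (simp add: commute_mod_def normal.rcos_sum FactGroup_def)

text \<open>By normality \<open>u \<otimes> a\<close> equals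
  \<open>u \<otimes> a \<otimes> inv u\<close>, an element of \<open>K\<close>, times
  \<open>u\<close>.\<close>

lemma r_coset_mult_right:
  assumes "K \<lhd> G" "u \<in> carrier G" "a \<in> K"
  shows "K #> (u \<otimes> a) = K #> u"
proof -
  interpret normal K G by fact
  have "a \<in> carrier G" using assms(3) by (rule mem_carrier)
  moreover have "u \<otimes> a \<otimes> inv u \<in> K" using assms by (simp add: inv_op_closed2)
  then have "u \<otimes> a \<in> K #> u" using assms calculation by (intro rcos_module_rev is_group) auto
  ultimately show ?thesis using repr_independence[of "u \<otimes> a" K u] assms(2) subgroup_axioms by simp
qed

lemma commute_mod_translate:
  assumes "K \<lhd> G" "u \<in> carrier G" "v \<in> carrier G" "a \<in> K" "b \<in> K"
  shows "commute_mod K (u \<otimes> a) v \<longleftrightarrow> commute_mod K u v"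
    and "commute_mod K u (v \<otimes> b) \<longleftrightarrow> commute_mod K u v"
    and "commute_mod K (u \<otimes> a) (v \<otimes> b) \<longleftrightarrow> commute_mod K u v"
proof -
  have "a \<in> carrier G" "b \<in> carrier G"
    using assms subgroup.mem_carrier[OF normal_imp_subgroup[OF assms(1)]] by auto
  then show "commute_mod K (u \<otimes> a) v \<longleftrightarrow> commute_mod K u v"
    and "commute_mod K u (v \<otimes> b) \<longleftrightarrow> commute_mod K u v"
    and "commute_mod K (u \<otimes> a) (v \<otimes> b) \<longleftrightarrow> commute_mod K u v"
    using assms by (simp_all add: commute_mod_iff r_coset_mult_right)
qed

lemma commute_mod_mono:
  assumes "subgroup H G" "subgroup K G" "H \<subseteq> K" "u \<in> carrier G" "v \<in> carrier G"
    and "commute_mod H u v"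
  shows "commute_mod K u v"
  using assms r_coset_eq_mono[of H K "u \<otimes> v" "v \<otimes> u"] by (simp add: commute_mod_def)

text \<open>This is the cancellation argument of \<open>commute_of_commuting_translates\<close>,
  carried out in \<open>G Mod K\<close>.\<close>

lemma commute_mod_of_translates:
  assumes K: "K \<lhd> G" and c: "x \<in> carrier G" "y \<in> carrier G" "a \<in> carrier G" "b \<in> carrier G"
    and "commute_mod K x y" "commute_mod K (x \<otimes> a) y" "commute_mod K x (y \<otimes> b)"
      "commute_mod K (x \<otimes> a) (y \<otimes> b)"
  shows "commute_mod K a b"
proof -
  have Q: "group (G Mod K)" using K by (rule normal.factorgroup_is_group)
  have mem: "K #> u \<in> carrier (G Mod K)" if "u \<in> carrier G" for u
    using that K by (simp add: FactGroup_def rcosetsI normal_imp_subgroup subgroup.subset)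
  have hom: "K #> (u \<otimes> v) = (K #> u) \<otimes>\<^bsub>G Mod K\<^esub> (K #> v)"
    if "u \<in> carrier G" "v \<in> carrier G" for u v
    using that K by (simp add: normal.rcos_sum FactGroup_def)
  show ?thesis
    unfolding commute_mod_iff[OF K c(3,4)]
    by (rule group.commute_of_commuting_translates[OF Q mem[OF c(1)] mem[OF c(2)] mem[OF c(3)] mem[OF c(4)]])
      (use assms(6-9) c in \<open>simp_all add: commute_mod_iff[OF K] hom\<close>)
qed

text \<open>The translates are collected in a list rather than a set because they need not be
  distinct.\<close>

definition translates_ok :: "nat \<Rightarrow> 'a set \<Rightarrow> ('a \<times> 'a) list \<Rightarrow> bool" where
  "translates_ok k K L \<longleftrightarrow> set L \<subseteq> carrier G \<times> carrier G \<and> length L = 4 ^ k \<and>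
     (\<forall>x\<in>carrier G. \<forall>y\<in>carrier G.
        length (filter (\<lambda>(s, t). commute_mod K (x \<otimes> s) (y \<otimes> t)) L) \<le> 3 ^ k)"

text \<open>Each pair splits into four, according to whether \<open>a\<close> and \<open>b\<close>
  are present. The new factors stand on the right, next to the existing translate, so that they
  disappear modulo a normal subgroup containing them.\<close>

definition refine_translates :: "'a \<Rightarrow> 'a \<Rightarrow> ('a \<times> 'a) list \<Rightarrow> ('a \<times> 'a) list" where
  "refine_translates a b L =
     concat (map (\<lambda>(s, t). [(s, t), (s \<otimes> a, t), (s, t \<otimes> b), (s \<otimes> a, t \<otimes> b)]) L)"

lemma refine_translates_simps [simp]:
  "refine_translates a b [] = []"
  "refine_translates a b ((s, t) # L) =
     [(s, t), (s \<otimes> a, t), (s, t \<otimes> b), (s \<otimes> a, t \<otimes> b)] @ refine_translates a b L"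
  by (simp_all add: refine_translates_def)

text \<open>A pair of \<open>L\<close> contributes at most three of its four refinements, since
  \<open>a\<close> and \<open>b\<close> would otherwise commute modulo \<open>K'\<close>. It
  contributes none unless it is already counted modulo \<open>K\<close>.\<close>

lemma length_filter_refine_translates:
  assumes K: "K \<lhd> G" and K': "K' \<lhd> G" "K' \<subseteq> K"
    and ab: "a \<in> K" "b \<in> K" "\<not> commute_mod K' a b"
    and xy: "x \<in> carrier G" "y \<in> carrier G" and L: "set L \<subseteq> carrier G \<times> carrier G"
  shows "length (filter (\<lambda>(s, t). commute_mod K' (x \<otimes> s) (y \<otimes> t)) (refine_translates a b L))
    \<le> 3 * length (filter (\<lambda>(s, t). commute_mod K (x \<otimes> s) (y \<otimes> t)) L)"
  using L
proof (induction L)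
  case (Cons p L)
  obtain s t where p: "p = (s, t)" by (cases p)
  have c: "s \<in> carrier G" "t \<in> carrier G" using Cons.prems p by auto
  have abc: "a \<in> carrier G" "b \<in> carrier G"
    using ab subgroup.mem_carrier[OF normal_imp_subgroup[OF K]] by auto
  have xs: "x \<otimes> s \<in> carrier G" "y \<otimes> t \<in> carrier G" using xy c by auto
  have assoc: "x \<otimes> (s \<otimes> a) = x \<otimes> s \<otimes> a" "y \<otimes> (t \<otimes> b) = y \<otimes> t \<otimes> b"
    using xy c abc by (simp_all add: m_assoc)
  note mono = commute_mod_mono[OF normal_imp_subgroup[OF K'(1)] normal_imp_subgroup[OF K] K'(2)]
  have fail: "\<not> (commute_mod K' (x \<otimes> s) (y \<otimes> t) \<and> commute_mod K' (x \<otimes> s \<otimes> a) (y \<otimes> t) \<and>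
      commute_mod K' (x \<otimes> s) (y \<otimes> t \<otimes> b) \<and> commute_mod K' (x \<otimes> s \<otimes> a) (y \<otimes> t \<otimes> b))"
    using commute_mod_of_translates[OF K'(1) xs abc] ab(3) by blast
  \<comment> \<open>Commutation modulo \<open>K'\<close> passes to the larger \<open>K\<close>, and
    multiplying by \<open>a\<close> or \<open>b\<close> changes nothing modulo
    \<open>K\<close>.\<close>
  have down: "commute_mod K (x \<otimes> s) (y \<otimes> t)"
    if "commute_mod K' (x \<otimes> s) (y \<otimes> t) \<or> commute_mod K' (x \<otimes> s \<otimes> a) (y \<otimes> t) \<or>
      commute_mod K' (x \<otimes> s) (y \<otimes> t \<otimes> b) \<or> commute_mod K' (x \<otimes> s \<otimes> a) (y \<otimes> t \<otimes> b)"
    using that mono xs abc commute_mod_translate[OF K xs ab(1,2)] m_closed by metis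
  have IH: "length (filter (\<lambda>(s, t). commute_mod K' (x \<otimes> s) (y \<otimes> t)) (refine_translates a b L))
    \<le> 3 * length (filter (\<lambda>(s, t). commute_mod K (x \<otimes> s) (y \<otimes> t)) L)"
    using Cons by simp
  show ?case
    using IH fail down by (auto simp: p assoc)
qed simp

lemma exists_translates:
  assumes rf: "residually_finite G" and nva: "\<not> virtually_abelian"
  shows "\<exists>K L. K \<lhd> G \<and> finite (rcosets K) \<and> translates_ok k K L"
proof (induction k)
  \<comment> \<open>Modulo the whole group everything commutes, and the single trivial translate
    meets the bound 1.\<close>
  case 0
  have "rcosets (carrier G) \<subseteq> {carrier G}"
    by (auto simp: RCOSETS_def coset_join2 subgroup_self)
  then have "finite (rcosets (carrier G))" by (rule finite_subset) simp
  moreover have "carrier G \<lhd> G" by (simp add: normal_inv_iff subgroup_self)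
  moreover have "translates_ok 0 (carrier G) [(\<one>, \<one>)]" by (simp add: translates_ok_def)
  ultimately show ?case by blast
next
  case (Suc k)
  then obtain K L where K: "K \<lhd> G" "finite (rcosets K)" and L: "translates_ok k K L" by blast
  have sK: "subgroup K G" using K(1) by (rule normal_imp_subgroup)
  \<comment> \<open>Otherwise \<open>K\<close> itself would witness that the group is virtually
    abelian.\<close>
  obtain a b where ab: "a \<in> K" "b \<in> K" "a \<otimes> b \<noteq> b \<otimes> a"
    using nva K by (auto simp: virtually_abelian_def)
  have abc: "a \<in> carrier G" "b \<in> carrier G" using ab subgroup.mem_carrier[OF sK] by auto
  \<comment> \<open>A normal subgroup that misses this commutator separates
    \<open>a \<otimes> b\<close> from \<open>b \<otimes> a\<close> in the quotient.\<close>
  let ?g = "a \<otimes> b \<otimes> inv (b \<otimes> a)"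
  have "?g \<noteq> \<one>" using ab(3) abc inv_equality[of "a \<otimes> b" "inv (b \<otimes> a)"] by auto
  then obtain N where N: "N \<lhd> G" "finite (rcosets N)" "?g \<notin> N"
    using rf abc by (auto simp: residually_finite_def FactGroup_def)
  have sN: "subgroup N G" using N(1) by (rule normal_imp_subgroup)
  define K' where "K' = K \<inter> N"
  have K': "K' \<lhd> G" "finite (rcosets K')" "K' \<subseteq> K"
    using normal_Int[OF K(1) N(1)] finite_rcosets_Int[OF sK sN K(2) N(2)] by (auto simp: K'_def)
  have ncomm: "\<not> commute_mod K' a b"
  proof
    assume "commute_mod K' a b"
    then have "commute_mod N a b"
      using commute_mod_mono[OF normal_imp_subgroup[OF K'(1)] sN _ abc] by (simp add: K'_def)
    then have "a \<otimes> b \<in> N #> (b \<otimes> a)"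
      using rcos_self[OF _ sN, of "a \<otimes> b"] abc by (simp add: commute_mod_def)
    then have "?g \<in> N" using subgroup.rcos_module_imp[OF sN is_group] abc by simp
    then show False using N(3) by simp
  qed
  have filt: "length (filter (\<lambda>(s, t). commute_mod K' (x \<otimes> s) (y \<otimes> t)) (refine_translates a b L))
      \<le> 3 * 3 ^ k" if xy: "x \<in> carrier G" "y \<in> carrier G" for x y
  proof -
    have "set L \<subseteq> carrier G \<times> carrier G" using L unfolding translates_ok_def by blast
    note length_filter_refine_translates[OF K(1) K'(1,3) ab(1,2) ncomm xy this]
    also have "3 * length (filter (\<lambda>(s, t). commute_mod K (x \<otimes> s) (y \<otimes> t)) L) \<le> 3 * 3 ^ k"
      using L xy unfolding translates_ok_def by (intro mult_le_mono2) blast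
    finally show ?thesis .
  qed
  have "set (refine_translates a b M) \<subseteq> carrier G \<times> carrier G"
    if "set M \<subseteq> carrier G \<times> carrier G" for M
    using that abc by (auto simp: refine_translates_def)
  moreover have "length (refine_translates a b M) = 4 * length M" for M
    by (induction M) auto
  ultimately have "translates_ok (Suc k) K' (refine_translates a b L)"
    using L filt by (simp add: translates_ok_def)
  then show ?case using K' by blast
qed

section \<open>Averaging over translates of a ball\<close>

text \<open>Double counting of the incidences \<open>P p z\<close>, with the entries of
  \<open>L\<close> taken with multiplicity.\<close>

lemma sum_list_card_filter:
  assumes "finite A"
  shows "(\<Sum>p\<leftarrow>L. card {z \<in> A. P p z}) = (\<Sum>z\<in>A. length (filter (\<lambda>p. P p z) L))"
proof (induction L)
  case (Cons p L)
  have "card {z \<in> A. P p z} = (\<Sum>z\<in>A. if P p z then 1 else 0)"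
    using assms by (simp add: sum.If_cases Int_def)
  then show ?case using Cons by (simp add: sum.distrib[symmetric] if_distrib cong: sum.cong) (rule sum.cong, auto)
qed simp

text \<open>For each translate \<open>(s, t)\<close>, dividing by it embeds the commuting pairs of
  the ball into the pairs of a slightly larger ball whose translate by \<open>(s, t)\<close>
  commutes modulo \<open>K\<close>. Summed over \<open>L\<close> this gives the left side; counted
  per pair of the larger ball, at most \<open>3 ^ k\<close> translates qualify.\<close>

lemma card_commuting_pairs_le:
  assumes Z: "finite_generating_set G Z" and L: "translates_ok k K L"
  obtains c where "\<And>n. 4 ^ k * card {(u, v) \<in> word_ball G Z n \<times> word_ball G Z n. u \<otimes> v = v \<otimes> u}
    \<le> 3 ^ k * (card (word_ball G Z (n + c)))\<^sup>2"
proof -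
  let ?B = "word_ball G Z"
  let ?C = "\<lambda>n. {(u, v) \<in> ?B n \<times> ?B n. u \<otimes> v = v \<otimes> u}"
  have Lc: "set L \<subseteq> carrier G \<times> carrier G" using L by (simp add: translates_ok_def)
  let ?S = "(\<lambda>p. inv (fst p)) ` set L \<union> (\<lambda>p. inv (snd p)) ` set L"
  have "fst p \<in> carrier G \<and> snd p \<in> carrier G" if "p \<in> set L" for p
    using that Lc by (cases p) auto
  then have "?S \<subseteq> carrier G" by auto
  then obtain c where c: "?S \<subseteq> ?B c"
    using finite_subset_word_ball[of ?S Z] by blast
  show ?thesis
  proof
    fix n
    let ?A = "?B (n + c) \<times> ?B (n + c)"
    let ?P = "\<lambda>p z. commute_mod K (fst z \<otimes> fst p) (snd z \<otimes> snd p)"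
    have fin: "finite ?A" using finite_word_ball[OF Z] by simp
    have le: "card (?C n) \<le> card {z \<in> ?A. ?P p z}" if p: "p \<in> set L" for p
    proof -
      obtain s t where st: "p = (s, t)" by (cases p)
      have stc: "s \<in> carrier G" "t \<in> carrier G" using p Lc st by auto
      have stB: "inv s \<in> ?B c" "inv t \<in> ?B c" using p c st by auto
      let ?f = "\<lambda>(u, v). (u \<otimes> inv s, v \<otimes> inv t)"
      have car: "u \<in> carrier G" if "u \<in> ?B n" for u using that word_ball_subset_carrier by auto
      have "inj_on ?f (?C n)" using stc car by (auto simp: inj_on_def)
      moreover have "?f ` ?C n \<subseteq> {z \<in> ?A. ?P p z}"
      proof -
        have "u \<otimes> inv s \<otimes> s = u" "v \<otimes> inv t \<otimes> t = v" if "u \<in> ?B n" "v \<in> ?B n" for u v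
          using that stc car by (simp_all add: m_assoc)
        then show ?thesis using stB word_ball_mult[OF Z]
          by (auto simp: st commute_mod_def)
      qed
      ultimately show ?thesis using fin by (intro card_inj_on_le) auto
    qed
    have "4 ^ k * card (?C n) = (\<Sum>p\<leftarrow>L. card (?C n))"
      using L by (simp add: translates_ok_def sum_list_triv)
    also have "\<dots> \<le> (\<Sum>p\<leftarrow>L. card {z \<in> ?A. ?P p z})"
      by (rule sum_list_mono) (rule le)
    also have "\<dots> = (\<Sum>z\<in>?A. length (filter (\<lambda>p. ?P p z) L))"
      by (rule sum_list_card_filter[OF fin])
    also have "\<dots> \<le> (\<Sum>z\<in>?A. 3 ^ k)"
    proof (rule sum_mono)
      fix z assume "z \<in> ?A"
      then have "fst z \<in> carrier G" "snd z \<in> carrier G" by (auto intro: subsetD[OF word_ball_subset_carrier])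
      then show "length (filter (\<lambda>p. ?P p z) L) \<le> 3 ^ k"
        using L unfolding translates_ok_def case_prod_beta by blast
    qed
    also have "\<dots> = 3 ^ k * (card (?B (n + c)))\<^sup>2"
      by (simp add: card_cartesian_product power2_eq_square)
    finally show "4 ^ k * card (?C n) \<le> 3 ^ k * (card (?B (n + c)))\<^sup>2" .
  qed
qed

text \<open>After division by the square of the ball size, the count leaves
  \<open>(3 / 4) ^ k\<close> times a squared growth ratio, which tends to 1.\<close>

lemma degree_of_commutativity_le:
  assumes growth: "subexponential_growth G" and Z: "finite_generating_set G Z"
    and L: "translates_ok k K L"
  shows "degree_of_commutativity G Z \<le> ereal ((3 / 4) ^ k)"
proof -
  let ?B = "word_ball G Z"
  let ?b = "\<lambda>n. real (card (?B n))"
  let ?C = "\<lambda>n. {(u, v) \<in> ?B n \<times> ?B n. u \<otimes> v = v \<otimes> u}"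
  obtain c where c: "\<And>n. 4 ^ k * card (?C n) \<le> 3 ^ k * (card (?B (n + c)))\<^sup>2"
    using card_commuting_pairs_le[OF Z L] by blast
  have upper: "real (card (?C n)) / (?b n)\<^sup>2 \<le> (3 / 4) ^ k * (?b (n + c) / ?b n)\<^sup>2" for n
  proof -
    have "real (4 ^ k * card (?C n)) \<le> real (3 ^ k * (card (?B (n + c)))\<^sup>2)"
      using c[of n] by (rule of_nat_mono)
    then have "real (card (?C n)) \<le> (3 / 4) ^ k * (?b (n + c))\<^sup>2"
      by (simp add: power_divide field_simps)
    then have "real (card (?C n)) / (?b n)\<^sup>2 \<le> (3 / 4) ^ k * (?b (n + c))\<^sup>2 / (?b n)\<^sup>2"
      by (rule divide_right_mono) simp
    then show ?thesis by (simp add: power_divide)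
  qed
  have "(\<lambda>n. (3 / 4) ^ k * (?b (n + c) / ?b n)\<^sup>2) \<longlonglongrightarrow> (3 / 4) ^ k * 1\<^sup>2"
    by (intro tendsto_intros word_ball_growth[OF growth Z])
  then have "(\<lambda>n. ereal ((3 / 4) ^ k * (?b (n + c) / ?b n)\<^sup>2)) \<longlonglongrightarrow> ereal ((3 / 4) ^ k)"
    by simp
  then have "limsup (\<lambda>n. ereal ((3 / 4) ^ k * (?b (n + c) / ?b n)\<^sup>2)) = ereal ((3 / 4) ^ k)"
    by (rule lim_imp_Limsup[rotated]) simp
  moreover have "degree_of_commutativity G Z \<le>
      limsup (\<lambda>n. ereal ((3 / 4) ^ k * (?b (n + c) / ?b n)\<^sup>2))"
    unfolding degree_of_commutativity_def
    by (rule Limsup_mono) (use upper in simp)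
  ultimately show ?thesis by simp
qed

lemma degree_of_commutativity_eq_0:
  assumes "residually_finite G" "subexponential_growth G" "finite_generating_set G Z"
    and "\<not> virtually_abelian"
  shows "degree_of_commutativity G Z = 0"
proof (rule antisym)
  \<comment> \<open>Translates exist for every \<open>k\<close>, and the degree does not depend on
    \<open>k\<close>, so the bounds can be sent to 0.\<close>
  have le: "degree_of_commutativity G Z \<le> ereal ((3 / 4) ^ k)" for k
    using exists_translates[OF assms(1,4), of k] degree_of_commutativity_le[OF assms(2,3)] by blast
  have "(\<lambda>k. ereal ((3 / 4) ^ k)) \<longlonglongrightarrow> ereal 0"
    unfolding lim_ereal by (rule LIMSEQ_realpow_zero) auto
  then show "degree_of_commutativity G Z \<le> 0"
    using le LIMSEQ_le_const unfolding zero_ereal_def by blast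
  show "0 \<le> degree_of_commutativity G Z"
    unfolding degree_of_commutativity_def by (rule le_Limsup) auto
qed

text \<open>The right side does not mention \<open>Z\<close>, which gives independence of the
  generating set.\<close>

lemma degree_of_commutativity_eq_0_iff:
  assumes "residually_finite G" "subexponential_growth G" "finite_generating_set G Z"
  shows "degree_of_commutativity G Z = 0 \<longleftrightarrow> \<not> virtually_abelian"
  using degree_of_commutativity_eq_0[OF assms] degree_of_commutativity_pos[OF assms(2,3)] by fastforce

end

theorem corollary1p6:
  fixes G :: "('a, 'b) monoid_scheme" and X Y :: "'a set"
  assumes "group G"
    and "finitely_generated G"
    and "residually_finite G"
    and "subexponential_growth G"
    and "finite_generating_set G X"
    and "finite_generating_set G Y"
  shows "degree_of_commutativity G X = 0 \<longleftrightarrow> degree_of_commutativity G Y = 0"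
  using assms by (simp add: group.degree_of_commutativity_eq_0_iff)

end
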